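(* Let $(\hat\lambda_i,\hat\alpha_i)_i$ be the eigensystem (eigenvalues and orthonormal eigenvectors) of $\frac1s\tilde{\boldsymbol H}_s^{1/2}K_s\tilde{\boldsymbol H}_s^{1/2}$, where $K_s:=[K(Z_i,Z_j)]_{i,j\in[s]}$, $\boldsymbol H_s=\boldsymbol I_s-\frac1s\boldsymbol 1_s\boldsymbol 1_s^\top$ and $\tilde{\boldsymbol H}_s=\frac s{s-1}\boldsymbol H_s$. Define $$G:=\sum_{i}\left(\frac{g_\lambda(\hat\lambda_i)-g_\lambda(0)}{\hat\lambda_i}\right)\hat\alpha_i\hat\alpha_i^\top,$$ the sum being over the nonzero eigenvalues. Then $$\hat\eta_\lambda=\frac1{n(n-1)}(a_1-a_2)+\frac1{m(m-1)}(a_3-a_4)-\frac2{nm}a_5,$$ where $a_1=\boldsymbol 1_n^\top A_1\boldsymbol 1_n$, $a_2=\mathrm{Tr}(A_1)$, $a_3=\boldsymbol 1_m^\top A_2\boldsymbol 1_m$, $a_4=\mathrm{Tr}(A_2)$, and $$a_5=\boldsymbol 1_m^\top\left(g_\lambda(0)K_{mn}+\frac1sK_{ms}\tilde{\boldsymbol H}_s^{1/2}G\tilde{\boldsymbol H}_s^{1/2}K_{ns}^\top\right)\boldsymbol 1_n,$$ with $A_1:=g_\lambda(0)K_n+\frac1sK_{ns}\tilde{\boldsymbol H}_s^{1/2}G\tilde{\boldsymbol H}_s^{1/2}K_{ns}^\top$ and $A_2:=g_\lambda(0)K_m+\frac1sK_{ms}\tilde{\boldsymbol H}_s^{1/2}G\tilde{\boldsymbol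 H}_s^{1/2}K_{ms}^\top$. Here $K_n:=[K(X_i,X_j)]_{i,j\in[n]}$, $K_m:=[K(Y_i,Y_j)]_{i,j\in[m]}$, $K_{ns}:=[K(X_i,Z_j)]_{i\in[n],j\in[s]}$, $K_{ms}:=[K(Y_i,Z_j)]_{i\in[m],j\in[s]}$ and $K_{mn}:=[K(Y_i,X_j)]_{i\in[m],j\in[n]}$.
   Context: $\mathcal X$ is a second countable topological space and $\mathcal H$ is an RKHS of real-valued functions on $\mathcal X$ with continuous reproducing kernel $K$, $\sup_xK(x,x)\le\kappa$. $X_1,\dots,X_n$, $Y_1,\dots,Y_m$, $Z_1,\dots,Z_s$ are points of $\mathcal X$ (samples), $n,m,s\ge2$. $[\ell]=\{1,\dots,\ell\}$, $\boldsymbol 1_\ell$ is the all-ones vector in $\mathbb R^\ell$, $\boldsymbol I_\ell$ the identity matrix. $\lambda>0$ and $g_\lambda:[0,\infty)\to[0,\infty)$ is a spectral regularizer. For a compact self-adjoint nonnegative operator $\mathcal B=\sum_i\tau_i\psi_i\otimes\psi_i$ on a separable Hilbert space ($(\psi_i)$ orthonormal eigenvectors for the nonzero eigenvalues $\tau_i$), $g_\lambda(\mathcal B)=\sum_ig_\lambda(\tau_i)\psi_i\otimes\psi_i+g_\lambda(0)\left(\boldsymbol I-\sum_i\psi_i\otimes\psi_i\right)$. The covariance estimator is $\hat\Sigma_{PQ}=\frac1{2s(s-1)}\sum_{i\ne j}(K(\cdot,Z_i)-K(\cdot,Z_j))\otimes_{\mathcal H}(K(\cdot,Z_i)-K(\cdot,Z_j))$,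 and the test statistic is $$\hat\eta_\lambda=\frac1{n(n-1)}\frac1{m(m-1)}\sum_{1\le i\ne j\le n}\ \sum_{1\le i'\ne j'\le m}\left\langle g_\lambda^{1/2}(\hat\Sigma_{PQ})A(X_i,Y_{i'}),\ g_\lambda^{1/2}(\hat\Sigma_{PQ})A(X_j,Y_{j'})\right\rangle_{\mathcal H},$$ where $A(x,y)=K(\cdot,x)-K(\cdot,y)$. *)

theory Defs
  imports "HOL-Analysis.Analysis"
begin

section \<open>Reproducing kernel Hilbert spaces\<close>

text \<open>
  A Hilbert space of real-valued functions on a set is given by a Hilbert space type together with
  a linear injection \<open>ev\<close> sending each vector to the function it denotes.  Because \<open>ev\<close> is
  injective, a vector and its function are interchangeable; the clause after injectivity says
  that the function \<open>K(\<cdot>,x)\<close> belongs to the space and reproduces evaluation at \<open>x\<close>.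
\<close>

definition rkhs ::
  "('h::{real_inner,complete_space} \<Rightarrow> 'x \<Rightarrow> real) \<Rightarrow> ('x \<Rightarrow> 'x \<Rightarrow> real) \<Rightarrow> bool" where
  "rkhs ev K \<longleftrightarrow>
     (\<forall>x. linear (\<lambda>f. ev f x)) \<and> inj ev \<and>
     (\<forall>x. \<exists>k. ev k = (\<lambda>y. K y x) \<and> (\<forall>f. ev f x = f \<bullet> k))"

text \<open>The function \<open>K(\<cdot>,x)\<close>, as an element of the Hilbert space.\<close>

definition kernel_section ::
  "('h::{real_inner,complete_space} \<Rightarrow> 'x \<Rightarrow> real) \<Rightarrow> ('x \<Rightarrow> 'x \<Rightarrow> real) \<Rightarrow> 'x \<Rightarrow> 'h" where
  "kernel_section ev K x = (THE k. ev k = (\<lambda>y. K y x))"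


section \<open>Functional calculus of a compact self-adjoint nonnegative operator\<close>

definition tensor :: "'h::real_inner \<Rightarrow> 'h \<Rightarrow> 'h \<Rightarrow> 'h" where
  "tensor a b = (\<lambda>f. (b \<bullet> f) *\<^sub>R a)"

text \<open>
  The orthonormal family of eigenvectors is presented as a set \<open>\<Psi>\<close> (its members are pairwise
  distinct), with \<open>\<tau> \<psi>\<close> the nonzero eigenvalue belonging to \<open>\<psi>\<close>.  Multiple eigenvalues are
  therefore repeated according to multiplicity.
\<close>

definition operator_eigensystem ::
  "('h::{real_inner,complete_space} \<Rightarrow> 'h) \<Rightarrow> 'h set \<Rightarrow> ('h \<Rightarrow> real) \<Rightarrow> bool" where
  "operator_eigensystem B \<Psi> \<tau> \<longleftrightarrow>
     pairwise orthogonal \<Psi> \<and> (\<forall>\<psi>\<in>\<Psi>. norm \<psi> = 1) \<and>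
     (\<forall>\<psi>\<in>\<Psi>. \<tau> \<psi> \<noteq> 0 \<and> B \<psi> = \<tau> \<psi> *\<^sub>R \<psi>) \<and>
     (\<forall>f. ((\<lambda>\<psi>. \<tau> \<psi> *\<^sub>R tensor \<psi> \<psi> f) has_sum B f) \<Psi>)"

text \<open>
  The eigensystem is unique only up to the choice of orthonormal bases of the eigenspaces, and the
  value below does not depend on that choice.
  For operators without an eigensystem the value is meaningless.
\<close>

definition spectral_apply ::
  "(real \<Rightarrow> real) \<Rightarrow> ('h::{real_inner,complete_space} \<Rightarrow> 'h) \<Rightarrow> 'h \<Rightarrow> 'h" where
  "spectral_apply g B =
     (let (\<Psi>, \<tau>) = (SOME (\<Psi>, \<tau>). operator_eigensystem B \<Psi> \<tau>)
      in (\<lambda>f. (\<Sum>\<^sub>\<infinity>\<psi>\<in>\<Psi>. g (\<tau> \<psi>) *\<^sub>R tensor \<psi> \<psi> f)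
             + g 0 *\<^sub>R (f - (\<Sum>\<^sub>\<infinity>\<psi>\<in>\<Psi>. tensor \<psi> \<psi> f))))"


section \<open>Covariance estimator and test statistic\<close>

text \<open>
  A sample of size \<open>l\<close> is a function on a finite index type with \<open>l\<close> elements.
\<close>

definition cov_estimator ::
  "('h::{real_inner,complete_space} \<Rightarrow> 'x \<Rightarrow> real) \<Rightarrow> ('x \<Rightarrow> 'x \<Rightarrow> real)
    \<Rightarrow> ('s::finite \<Rightarrow> 'x) \<Rightarrow> 'h \<Rightarrow> 'h" where
  "cov_estimator ev K Z = (\<lambda>f.
     (1 / (2 * real CARD('s) * (real CARD('s) - 1))) *\<^sub>R
     (\<Sum>i\<in>UNIV. \<Sum>j\<in>UNIV - {i}.
        tensor (kernel_section ev K (Z i) - kernel_section ev K (Z j))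
               (kernel_section ev K (Z i) - kernel_section ev K (Z j)) f))"

text \<open>The operator \<open>g\<^sup>1\<^sup>/\<^sup>2(\<Sigma>)\<close> is the functional calculus at \<open>\<Sigma>\<close> of the function \<open>sqrt \<circ> g\<close>.\<close>

definition test_statistic ::
  "('h::{real_inner,complete_space} \<Rightarrow> 'x \<Rightarrow> real) \<Rightarrow> ('x \<Rightarrow> 'x \<Rightarrow> real) \<Rightarrow> (real \<Rightarrow> real)
    \<Rightarrow> ('n::finite \<Rightarrow> 'x) \<Rightarrow> ('m::finite \<Rightarrow> 'x) \<Rightarrow> ('s::finite \<Rightarrow> 'x) \<Rightarrow> real" where
  "test_statistic ev K g X Y Z =
     (let A = (\<lambda>x y. kernel_section ev K x - kernel_section ev K y);
          T = spectral_apply (\<lambda>t. sqrt (g t)) (cov_estimator ev K Z)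
      in 1 / (real CARD('n) * (real CARD('n) - 1)) * (1 / (real CARD('m) * (real CARD('m) - 1))) *
         (\<Sum>i\<in>UNIV. \<Sum>j\<in>UNIV - {i}. \<Sum>i'\<in>UNIV. \<Sum>j'\<in>UNIV - {i'}.
            T (A (X i) (Y i')) \<bullet> T (A (X j) (Y j'))))"


section \<open>Matrices\<close>

definition ones :: "real ^ 'l" where
  "ones = (\<chi> i. 1)"

definition outer :: "real ^ 'k \<Rightarrow> real ^ 'l \<Rightarrow> real ^ 'l ^ 'k" where
  "outer u v = (\<chi> i j. u $ i * v $ j)"

definition kernel_matrix ::
  "('x \<Rightarrow> 'x \<Rightarrow> real) \<Rightarrow> ('k \<Rightarrow> 'x) \<Rightarrow> ('l \<Rightarrow> 'x) \<Rightarrow> real ^ 'l ^ 'k" where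
  "kernel_matrix K U V = (\<chi> i j. K (U i) (V j))"

definition centering :: "real ^ 's ^ 's" where
  "centering = mat 1 - (1 / real CARD('s)) *\<^sub>R outer ones ones"

definition scaled_centering :: "real ^ 's ^ 's" where
  "scaled_centering = (real CARD('s) / (real CARD('s) - 1)) *\<^sub>R centering"

definition psd :: "real ^ 'n ^ 'n \<Rightarrow> bool" where
  "psd M \<longleftrightarrow> transpose M = M \<and> (\<forall>v. 0 \<le> v \<bullet> (M *v v))"

definition matrix_sqrt :: "real ^ 'n ^ 'n \<Rightarrow> real ^ 'n ^ 'n" where
  "matrix_sqrt M = (THE R. psd R \<and> R ** R = M)"

text \<open>
  All eigenpairs are listed, including those with eigenvalue \<open>0\<close>; a full orthonormal eigenbasis has
  as many members as the matrix has rows, so the rows can index it.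
\<close>

definition matrix_eigensystem ::
  "real ^ 's ^ 's \<Rightarrow> ('s \<Rightarrow> real) \<Rightarrow> ('s \<Rightarrow> real ^ 's) \<Rightarrow> bool" where
  "matrix_eigensystem M l \<alpha> \<longleftrightarrow>
     (\<forall>i j. \<alpha> i \<bullet> \<alpha> j = (if i = j then 1 else 0)) \<and> (\<forall>i. M *v \<alpha> i = l i *\<^sub>R \<alpha> i)"

end

theory Submission
  imports Defs
begin

text \<open>
  Let \<open>R\<close> be the square root of the scaled centering matrix and put
  \<open>w\<^sub>j = s\<^sup>-\<^sup>1\<^sup>/\<^sup>2 \<Sum>\<^sub>p R\<^sub>j\<^sub>p K(\<cdot>,Z\<^sub>p)\<close>.  Then \<open>\<Sigma> = \<Sum>\<^sub>j w\<^sub>j \<otimes> w\<^sub>j\<close>, while the Gram matrix of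
  \<open>w\<close> is \<open>R K\<^sub>s R / s\<close>.  Hence \<open>v\<^sub>i = \<Sum>\<^sub>j (\<alpha>\<^sub>i)\<^sub>j w\<^sub>j\<close> is an orthogonal family with
  \<open>\<parallel>v\<^sub>i\<parallel>\<^sup>2 = l\<^sub>i\<close> and \<open>\<Sigma> = \<Sum>\<^sub>i v\<^sub>i \<otimes> v\<^sub>i\<close>, so the normalised nonzero \<open>v\<^sub>i\<close> diagonalise
  \<open>\<Sigma>\<close>, and \<open>\<langle>g\<^sup>1\<^sup>/\<^sup>2(\<Sigma>) f, g\<^sup>1\<^sup>/\<^sup>2(\<Sigma>) f'\<rangle>\<close> becomes a finite sum of products
  \<open>\<langle>v\<^sub>i, f\<rangle> \<langle>v\<^sub>i, f'\<rangle>\<close>.  Spectral projections do not depend on the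
  eigensystem chosen, so this holds for the one that \<open>spectral_apply\<close> picks.  Expanding the four-fold sum bilinearly then gives the formula.
\<close>

section \<open>Independence of the functional calculus from the chosen eigensystem\<close>

lemma tensor_apply: "tensor a b f = (b \<bullet> f) *\<^sub>R a"
  by (simp add: tensor_def)

lemma operator_eigensystem_inner:
  assumes "operator_eigensystem B \<Psi> \<tau>" "\<psi> \<in> \<Psi>" "\<phi> \<in> \<Psi>"
  shows "\<psi> \<bullet> \<phi> = (if \<psi> = \<phi> then 1 else 0)"
  using assms unfolding operator_eigensystem_def pairwise_def orthogonal_def
  by (auto simp: norm_eq_1)

lemma operator_eigensystem_apply:
  assumes "operator_eigensystem B \<Psi> \<tau>" "finite \<Psi>"
  shows "B f = (\<Sum>\<psi>\<in>\<Psi>. (\<tau> \<psi> * (\<psi> \<bullet> f)) *\<^sub>R \<psi>)"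
proof -
  have "((\<lambda>\<psi>. \<tau> \<psi> *\<^sub>R tensor \<psi> \<psi> f) has_sum B f) \<Psi>"
    using assms(1) by (auto simp: operator_eigensystem_def)
  then have "B f = (\<Sum>\<psi>\<in>\<Psi>. \<tau> \<psi> *\<^sub>R tensor \<psi> \<psi> f)"
    using assms(2) by (metis has_sum_unique has_sum_finite)
  then show ?thesis by (simp add: tensor_apply)
qed

text \<open>Eigenvectors for nonzero eigenvalues lie in the range of \<open>B\<close>, which is
  contained in the span of \<open>\<Phi>\<close>; being orthonormal, they are independent, so there
  are at most \<open>card \<Phi>\<close> of them.\<close>

lemma finite_operator_eigensystem:
  assumes \<Phi>: "operator_eigensystem B \<Phi> \<mu>" "finite \<Phi>"
    and \<Psi>: "operator_eigensystem B \<Psi> \<tau>"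
  shows "finite \<Psi>"
proof -
  have "\<Psi> \<subseteq> span \<Phi>"
  proof
    fix \<psi> assume "\<psi> \<in> \<Psi>"
    then have "\<tau> \<psi> \<noteq> 0" "B \<psi> = \<tau> \<psi> *\<^sub>R \<psi>"
      using \<Psi> by (auto simp: operator_eigensystem_def)
    then have "\<psi> = (1 / \<tau> \<psi>) *\<^sub>R B \<psi>" by simp
    also have "\<dots> \<in> span \<Phi>"
      unfolding operator_eigensystem_apply[OF \<Phi>]
      by (intro span_scale span_sum) (auto intro: span_base)
    finally show "\<psi> \<in> span \<Phi>" .
  qed
  moreover have "independent \<Psi>"
    using \<Psi> by (intro pairwise_orthogonal_independent) (auto simp: operator_eigensystem_def)
  ultimately show ?thesis
    using independent_span_bound[OF \<Phi>(2)] by blast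
qed

text \<open>Compute \<open>\<psi> \<bullet> B \<phi>\<close> twice: from the eigenvalue equation of
  \<open>\<phi>\<close>, and from the expansion of \<open>B\<close> along \<open>\<Psi>\<close>,
  where only the term of \<open>\<psi>\<close> survives.\<close>

lemma operator_eigensystem_eigenvalue_eq:
  assumes \<Phi>: "operator_eigensystem B \<Phi> \<mu>"
    and \<Psi>: "operator_eigensystem B \<Psi> \<tau>" "finite \<Psi>"
    and mem: "\<phi> \<in> \<Phi>" "\<psi> \<in> \<Psi>" and ne: "\<psi> \<bullet> \<phi> \<noteq> 0"
  shows "\<tau> \<psi> = \<mu> \<phi>"
proof -
  have "\<mu> \<phi> * (\<psi> \<bullet> \<phi>) = \<psi> \<bullet> B \<phi>"
    using \<Phi> mem by (simp add: operator_eigensystem_def)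
  also have "\<dots> = (\<Sum>\<xi>\<in>\<Psi>. \<tau> \<xi> * (\<xi> \<bullet> \<phi>) * (\<psi> \<bullet> \<xi>))"
    by (simp add: operator_eigensystem_apply[OF \<Psi>] inner_sum_right)
  also have "\<dots> = (\<Sum>\<xi>\<in>\<Psi>. if \<psi> = \<xi> then \<tau> \<xi> * (\<xi> \<bullet> \<phi>) else 0)"
    using mem by (intro sum.cong) (auto simp: operator_eigensystem_inner[OF \<Psi>(1)])
  also have "\<dots> = \<tau> \<psi> * (\<psi> \<bullet> \<phi>)"
    using \<Psi>(2) mem by simp
  finally show ?thesis using ne by simp
qed

text \<open>Dividing \<open>B \<phi> = \<mu> \<phi> *\<^sub>R \<phi>\<close> by
  \<open>\<mu> \<phi>\<close> puts \<open>\<phi>\<close> into the span of \<open>\<Psi>\<close>. The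
  quotient of eigenvalues disappears because each coefficient is zero unless the eigenvalues
  agree.\<close>

lemma operator_eigensystem_expand:
  assumes \<Phi>: "operator_eigensystem B \<Phi> \<mu>"
    and \<Psi>: "operator_eigensystem B \<Psi> \<tau>" "finite \<Psi>" and "\<phi> \<in> \<Phi>"
  shows "\<phi> = (\<Sum>\<psi>\<in>\<Psi>. (\<psi> \<bullet> \<phi>) *\<^sub>R \<psi>)"
proof -
  have \<mu>: "\<mu> \<phi> \<noteq> 0" "B \<phi> = \<mu> \<phi> *\<^sub>R \<phi>"
    using \<Phi> \<open>\<phi> \<in> \<Phi>\<close> by (auto simp: operator_eigensystem_def)
  have "\<mu> \<phi> *\<^sub>R \<phi> = (\<Sum>\<psi>\<in>\<Psi>. (\<tau> \<psi> * (\<psi> \<bullet> \<phi>)) *\<^sub>R \<psi>)"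
    using \<mu>(2) operator_eigensystem_apply[OF \<Psi>] by metis
  also have "\<dots> = (\<Sum>\<psi>\<in>\<Psi>. (\<mu> \<phi> * (\<psi> \<bullet> \<phi>)) *\<^sub>R \<psi>)"
  proof (rule sum.cong[OF refl])
    fix \<psi> assume "\<psi> \<in> \<Psi>"
    then show "(\<tau> \<psi> * (\<psi> \<bullet> \<phi>)) *\<^sub>R \<psi> = (\<mu> \<phi> * (\<psi> \<bullet> \<phi>)) *\<^sub>R \<psi>"
      using operator_eigensystem_eigenvalue_eq[OF \<Phi> \<Psi> \<open>\<phi> \<in> \<Phi>\<close>, of \<psi>]
      by (cases "\<psi> \<bullet> \<phi> = 0") auto
  qed
  also have "\<dots> = \<mu> \<phi> *\<^sub>R (\<Sum>\<psi>\<in>\<Psi>. (\<psi> \<bullet> \<phi>) *\<^sub>R \<psi>)"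
    by (simp add: scaleR_sum_right)
  finally show ?thesis using \<mu>(1) by simp
qed

text \<open>Expand each \<open>\<psi>\<close> along \<open>\<Phi>\<close>, exchange
  \<open>h (\<tau> \<psi>)\<close> for \<open>h (\<mu> \<phi>)\<close> (they agree whenever the
  inner product is nonzero), and sum over \<open>\<psi>\<close> first, which restores
  \<open>\<phi> \<bullet> f\<close>.\<close>

lemma eigensystem_sum_independent:
  assumes \<Phi>: "operator_eigensystem B \<Phi> \<mu>" "finite \<Phi>"
    and \<Psi>: "operator_eigensystem B \<Psi> \<tau>" "finite \<Psi>"
  shows "(\<Sum>\<psi>\<in>\<Psi>. (h (\<tau> \<psi>) * (\<psi> \<bullet> f)) *\<^sub>R \<psi>) = (\<Sum>\<phi>\<in>\<Phi>. (h (\<mu> \<phi>) * (\<phi> \<bullet> f)) *\<^sub>R \<phi>)"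
proof -
  have "(\<Sum>\<psi>\<in>\<Psi>. (h (\<tau> \<psi>) * (\<psi> \<bullet> f)) *\<^sub>R \<psi>)
      = (\<Sum>\<psi>\<in>\<Psi>. \<Sum>\<phi>\<in>\<Phi>. (h (\<tau> \<psi>) * (\<psi> \<bullet> f) * (\<phi> \<bullet> \<psi>)) *\<^sub>R \<phi>)"
  proof (rule sum.cong[OF refl])
    fix \<psi> assume "\<psi> \<in> \<Psi>"
    then have "(h (\<tau> \<psi>) * (\<psi> \<bullet> f)) *\<^sub>R \<psi>
        = (h (\<tau> \<psi>) * (\<psi> \<bullet> f)) *\<^sub>R (\<Sum>\<phi>\<in>\<Phi>. (\<phi> \<bullet> \<psi>) *\<^sub>R \<phi>)"
      using operator_eigensystem_expand[OF \<Psi>(1) \<Phi>] by metis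
    then show "(h (\<tau> \<psi>) * (\<psi> \<bullet> f)) *\<^sub>R \<psi>
        = (\<Sum>\<phi>\<in>\<Phi>. (h (\<tau> \<psi>) * (\<psi> \<bullet> f) * (\<phi> \<bullet> \<psi>)) *\<^sub>R \<phi>)"
      by (simp add: scaleR_sum_right)
  qed
  also have "\<dots> = (\<Sum>\<psi>\<in>\<Psi>. \<Sum>\<phi>\<in>\<Phi>. (h (\<mu> \<phi>) * ((\<psi> \<bullet> \<phi>) * (\<psi> \<bullet> f))) *\<^sub>R \<phi>)"
  proof (intro sum.cong refl)
    fix \<psi> \<phi> assume "\<psi> \<in> \<Psi>" "\<phi> \<in> \<Phi>"
    then show "(h (\<tau> \<psi>) * (\<psi> \<bullet> f) * (\<phi> \<bullet> \<psi>)) *\<^sub>R \<phi> = (h (\<mu> \<phi>) * ((\<psi> \<bullet> \<phi>) * (\<psi> \<bullet> f))) *\<^sub>R \<phi>"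
      using operator_eigensystem_eigenvalue_eq[OF \<Phi>(1) \<Psi>, of \<phi> \<psi>]
      by (cases "\<psi> \<bullet> \<phi> = 0") (auto simp: inner_commute)
  qed
  also have "\<dots> = (\<Sum>\<phi>\<in>\<Phi>. \<Sum>\<psi>\<in>\<Psi>. (h (\<mu> \<phi>) * ((\<psi> \<bullet> \<phi>) * (\<psi> \<bullet> f))) *\<^sub>R \<phi>)"
    by (rule sum.swap)
  also have "\<dots> = (\<Sum>\<phi>\<in>\<Phi>. (h (\<mu> \<phi>) * (\<phi> \<bullet> f)) *\<^sub>R \<phi>)"
  proof (rule sum.cong[OF refl])
    fix \<phi> assume "\<phi> \<in> \<Phi>"
    then have "\<phi> \<bullet> f = (\<Sum>\<psi>\<in>\<Psi>. (\<psi> \<bullet> \<phi>) *\<^sub>R \<psi>) \<bullet> f"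
      using operator_eigensystem_expand[OF \<Phi>(1) \<Psi>] by metis
    then have "\<phi> \<bullet> f = (\<Sum>\<psi>\<in>\<Psi>. (\<psi> \<bullet> \<phi>) * (\<psi> \<bullet> f))"
      by (simp add: inner_sum_left)
    then show "(\<Sum>\<psi>\<in>\<Psi>. (h (\<mu> \<phi>) * ((\<psi> \<bullet> \<phi>) * (\<psi> \<bullet> f))) *\<^sub>R \<phi>) = (h (\<mu> \<phi>) * (\<phi> \<bullet> f)) *\<^sub>R \<phi>"
      by (simp add: sum_distrib_left flip: scaleR_sum_left)
  qed
  finally show ?thesis .
qed

text \<open>One finite eigensystem makes all of them finite, so the infinite sums collapse and the
  arbitrary choice is harmless. Gathering the multiples of \<open>f\<close> leaves
  \<open>h - h 0\<close> on the nonzero eigenvalues.\<close>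

lemma spectral_apply_finite:
  assumes \<Phi>: "operator_eigensystem B \<Phi> \<mu>" "finite \<Phi>"
  shows "spectral_apply h B f = h 0 *\<^sub>R f + (\<Sum>\<phi>\<in>\<Phi>. ((h (\<mu> \<phi>) - h 0) * (\<phi> \<bullet> f)) *\<^sub>R \<phi>)"
proof -
  obtain \<Psi> \<tau> where some: "(SOME (\<Psi>, \<tau>). operator_eigensystem B \<Psi> \<tau>) = (\<Psi>, \<tau>)"
    by (cases "SOME (\<Psi>, \<tau>). operator_eigensystem B \<Psi> \<tau>") auto
  have "case (SOME (\<Psi>, \<tau>). operator_eigensystem B \<Psi> \<tau>) of (\<Psi>, \<tau>) \<Rightarrow> operator_eigensystem B \<Psi> \<tau>"
    by (rule someI[of _ "(\<Phi>, \<mu>)"]) (simp add: \<Phi>)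
  then have \<Psi>: "operator_eigensystem B \<Psi> \<tau>" by (simp add: some)
  have fin: "finite \<Psi>" by (rule finite_operator_eigensystem[OF \<Phi> \<Psi>])
  have "spectral_apply h B f
      = (\<Sum>\<psi>\<in>\<Psi>. (h (\<tau> \<psi>) * (\<psi> \<bullet> f)) *\<^sub>R \<psi>) + h 0 *\<^sub>R (f - (\<Sum>\<psi>\<in>\<Psi>. (\<psi> \<bullet> f) *\<^sub>R \<psi>))"
    by (simp add: spectral_apply_def some tensor_apply fin)
  also have "\<dots> = h 0 *\<^sub>R f + (\<Sum>\<psi>\<in>\<Psi>. ((h (\<tau> \<psi>) - h 0) * (\<psi> \<bullet> f)) *\<^sub>R \<psi>)"
    by (simp add: algebra_simps sum_subtractf scaleR_sum_right)
  also have "\<dots> = h 0 *\<^sub>R f + (\<Sum>\<phi>\<in>\<Phi>. ((h (\<mu> \<phi>) - h 0) * (\<phi> \<bullet> f)) *\<^sub>R \<phi>)"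
    by (simp only: eigensystem_sum_independent[OF \<Phi> \<Psi> fin, of "\<lambda>t. h t - h 0"])
  finally show ?thesis .
qed

section \<open>Functional calculus of a sum of rank-one operators over an orthogonal family\<close>

text \<open>Each nonzero \<open>v i\<close> is an eigenvector whose eigenvalue equals its squared
  norm \<open>l i\<close>. Normalising it twice therefore produces the denominator
  \<open>l i\<close>.\<close>

lemma spectral_apply_orthogonal_family:
  fixes v :: "'i::finite \<Rightarrow> 'h::{real_inner,complete_space}"
  assumes B: "\<And>f. B f = (\<Sum>i\<in>UNIV. (v i \<bullet> f) *\<^sub>R v i)"
    and orth: "\<And>i j. v i \<bullet> v j = (if i = j then l i else 0)"
  shows "spectral_apply h B f
      = h 0 *\<^sub>R f + (\<Sum>i | l i \<noteq> 0. ((h (l i) - h 0) / l i * (v i \<bullet> f)) *\<^sub>R v i)"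
proof -
  define u where "u i = (1 / sqrt (l i)) *\<^sub>R v i" for i
  define I where "I = {i. l i \<noteq> 0}"
  have l_nonneg: "l i \<ge> 0" for i
    using orth[of i i] inner_ge_zero[of "v i"] by simp
  have v0: "v i = 0" if "i \<notin> I" for i
    using orth[of i i] that by (simp add: I_def)
  have uu: "u i \<bullet> u j = (if i = j then 1 else 0)" if "i \<in> I" for i j
    using that l_nonneg[of i] by (auto simp: u_def orth I_def)
  have inj: "inj_on u I"
    by (rule inj_onI) (metis uu zero_neq_one)
  \<comment> \<open>If \<open>l i = 0\<close>, both sides are zero by the convention for division by
    zero.\<close>
  have rescale: "(c * (u i \<bullet> f)) *\<^sub>R u i = (c / l i * (v i \<bullet> f)) *\<^sub>R v i" for c i f
    using l_nonneg[of i] by (simp add: u_def divide_simps flip: power2_eq_square)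
  \<comment> \<open>An eigensystem assigns eigenvalues to vectors rather than to indices, so the
    index is recovered from \<open>u i\<close>.\<close>
  define \<mu> where "\<mu> \<psi> = l (the_inv_into I u \<psi>)" for \<psi>
  have \<mu>: "\<mu> (u i) = l i" if "i \<in> I" for i
    using that inj by (simp add: \<mu>_def the_inv_into_f_f)
  have eig: "B (v i) = l i *\<^sub>R v i" for i
  proof -
    have "B (v i) = (\<Sum>j\<in>UNIV. if j = i then l i *\<^sub>R v i else 0)"
      unfolding B by (intro sum.cong) (auto simp: orth)
    then show ?thesis by simp
  qed
  have B_scale: "B (c *\<^sub>R f) = c *\<^sub>R B f" for c f
    by (simp add: B scaleR_sum_right)
  have Bf: "B f = (\<Sum>i\<in>I. l i *\<^sub>R tensor (u i) (u i) f)" for f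
  proof -
    have "B f = (\<Sum>i\<in>I. (v i \<bullet> f) *\<^sub>R v i)"
      unfolding B by (rule sum.mono_neutral_right) (auto simp: v0)
    also have "\<dots> = (\<Sum>i\<in>I. l i *\<^sub>R tensor (u i) (u i) f)"
      by (intro sum.cong) (auto simp: tensor_apply rescale I_def)
    finally show ?thesis .
  qed
  have sys: "operator_eigensystem B (u ` I) \<mu>"
    unfolding operator_eigensystem_def
  proof (intro conjI ballI allI)
    show "pairwise orthogonal (u ` I)"
      by (auto simp: pairwise_def orthogonal_def uu)
    fix \<psi> assume "\<psi> \<in> u ` I"
    then obtain i where i: "i \<in> I" "\<psi> = u i" by blast
    show "norm \<psi> = 1" by (simp add: i norm_eq_1 uu)
    show "\<mu> \<psi> \<noteq> 0" using i by (simp add: \<mu>) (simp add: I_def)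
    have "B (u i) = l i *\<^sub>R u i"
      unfolding u_def B_scale eig by (simp add: mult.commute)
    then show "B \<psi> = \<mu> \<psi> *\<^sub>R \<psi>" by (simp add: i \<mu>)
  next
    fix f
    have "B f = (\<Sum>\<psi>\<in>u ` I. \<mu> \<psi> *\<^sub>R tensor \<psi> \<psi> f)"
      by (simp add: Bf sum.reindex[OF inj] \<mu>)
    then show "((\<lambda>\<psi>. \<mu> \<psi> *\<^sub>R tensor \<psi> \<psi> f) has_sum B f) (u ` I)"
      by (simp add: has_sum_finite)
  qed
  have "spectral_apply h B f = h 0 *\<^sub>R f + (\<Sum>\<phi>\<in>u ` I. ((h (\<mu> \<phi>) - h 0) * (\<phi> \<bullet> f)) *\<^sub>R \<phi>)"
    by (rule spectral_apply_finite[OF sys]) simp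
  also have "(\<Sum>\<phi>\<in>u ` I. ((h (\<mu> \<phi>) - h 0) * (\<phi> \<bullet> f)) *\<^sub>R \<phi>)
      = (\<Sum>i\<in>I. ((h (l i) - h 0) / l i * (v i \<bullet> f)) *\<^sub>R v i)"
    by (simp add: sum.reindex[OF inj] \<mu> rescale)
  finally show ?thesis by (simp add: I_def)
qed

text \<open>Taking the inner product of two images squares \<open>h\<close>; with \<open>h\<close> a
  square root, this is how the root disappears from the final formula.\<close>

lemma spectral_apply_inner_orthogonal_family:
  fixes v :: "'i::finite \<Rightarrow> 'h::{real_inner,complete_space}"
  assumes B: "\<And>f. B f = (\<Sum>i\<in>UNIV. (v i \<bullet> f) *\<^sub>R v i)"
    and orth: "\<And>i j. v i \<bullet> v j = (if i = j then l i else 0)"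
  shows "spectral_apply h B f \<bullet> spectral_apply h B f'
      = (h 0)\<^sup>2 * (f \<bullet> f') + (\<Sum>i | l i \<noteq> 0. ((h (l i))\<^sup>2 - (h 0)\<^sup>2) / l i * (v i \<bullet> f) * (v i \<bullet> f'))"
proof -
  define I where "I = {i. l i \<noteq> 0}"
  define c where "c i = (h (l i) - h 0) / l i" for i
  have T: "spectral_apply h B f = h 0 *\<^sub>R f + (\<Sum>i\<in>I. (c i * (v i \<bullet> f)) *\<^sub>R v i)" for f
    unfolding I_def c_def by (rule spectral_apply_orthogonal_family[OF B orth])
  have diag: "(\<Sum>i\<in>I. (c i * (v i \<bullet> f)) *\<^sub>R v i) \<bullet> (\<Sum>i\<in>I. (c i * (v i \<bullet> f')) *\<^sub>R v i)
      = (\<Sum>i\<in>I. (c i)\<^sup>2 * l i * (v i \<bullet> f) * (v i \<bullet> f'))"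
  proof -
    have "(\<Sum>i\<in>I. (c i * (v i \<bullet> f)) *\<^sub>R v i) \<bullet> (\<Sum>i\<in>I. (c i * (v i \<bullet> f')) *\<^sub>R v i)
        = (\<Sum>i\<in>I. \<Sum>j\<in>I. if i = j then (c i)\<^sup>2 * l i * (v i \<bullet> f) * (v i \<bullet> f') else 0)"
      unfolding inner_sum_left inner_sum_right
      by (intro sum.cong refl) (auto simp: orth power2_eq_square)
    then show ?thesis by simp
  qed
  \<comment> \<open>The cross terms and the quadratic term combine by
    \<open>(a - b) * (2 * b + (a - b)) = a\<^sup>2 - b\<^sup>2\<close>.\<close>
  have coeff: "2 * h 0 * c i + (c i)\<^sup>2 * l i = ((h (l i))\<^sup>2 - (h 0)\<^sup>2) / l i" if "i \<in> I" for i
    using that by (simp add: c_def I_def field_simps power2_eq_square)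
  have "spectral_apply h B f \<bullet> spectral_apply h B f'
      = (h 0)\<^sup>2 * (f \<bullet> f') + (\<Sum>i\<in>I. (2 * h 0 * c i + (c i)\<^sup>2 * l i) * (v i \<bullet> f) * (v i \<bullet> f'))"
    unfolding T inner_add_left inner_add_right diag
    by (simp add: inner_sum_left inner_sum_right sum.distrib sum_distrib_left inner_commute
        algebra_simps power2_eq_square)
  also have "(\<Sum>i\<in>I. (2 * h 0 * c i + (c i)\<^sup>2 * l i) * (v i \<bullet> f) * (v i \<bullet> f'))
      = (\<Sum>i\<in>I. ((h (l i))\<^sup>2 - (h 0)\<^sup>2) / l i * (v i \<bullet> f) * (v i \<bullet> f'))"
    by (intro sum.cong) (auto simp: coeff)
  finally show ?thesis by (simp add: I_def)
qed

section \<open>Gram matrices\<close>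

text \<open>A square matrix with orthonormal rows has its transpose as a right inverse, hence also
  as a left inverse, so its columns are orthonormal too.\<close>

lemma orthonormal_family_complete:
  fixes \<alpha> :: "'s::finite \<Rightarrow> real ^ 's"
  assumes "\<And>i j. \<alpha> i \<bullet> \<alpha> j = (if i = j then 1 else 0)"
  shows "(\<Sum>i\<in>UNIV. \<alpha> i $ p * \<alpha> i $ q) = (if p = q then 1 else 0)"
proof -
  define P :: "real ^ 's ^ 's" where "P = (\<chi> i. \<alpha> i)"
  have "P ** transpose P = mat 1"
    using assms by (simp add: P_def matrix_matrix_mult_def transpose_def mat_def vec_eq_iff inner_vec_def)
  then have "transpose P ** P = mat 1"
    by (simp add: matrix_left_right_inverse)
  then have "(transpose P ** P) $ p $ q = (mat 1 :: real ^ 's ^ 's) $ p $ q" by simp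
  then show ?thesis
    by (simp add: P_def matrix_matrix_mult_def transpose_def mat_def)
qed

lemma scaleR_double_sum:
  fixes y :: "'b \<Rightarrow> 'v::real_vector"
  shows "(\<Sum>p\<in>A. x p) *\<^sub>R (\<Sum>q\<in>B. y q) = (\<Sum>p\<in>A. \<Sum>q\<in>B. x p *\<^sub>R y q)"
  by (simp only: scaleR_sum_left) (simp only: scaleR_sum_right)

lemma inner_double_sum:
  "(\<Sum>p\<in>A. x p) \<bullet> (\<Sum>q\<in>B. y q) = (\<Sum>p\<in>A. \<Sum>q\<in>B. x p \<bullet> y q)"
  by (simp only: inner_sum_left) (simp only: inner_sum_right)

text \<open>The inner product of two linear combinations of \<open>w\<close> is the bilinear form of
  the Gram matrix in the coefficient vectors.\<close>

lemma gram_eigensystem_inner: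
  fixes w :: "'s::finite \<Rightarrow> 'h::real_inner"
  assumes sys: "matrix_eigensystem (\<chi> p q. w p \<bullet> w q) l \<alpha>"
  shows "(\<Sum>p\<in>UNIV. \<alpha> i $ p *\<^sub>R w p) \<bullet> (\<Sum>q\<in>UNIV. \<alpha> j $ q *\<^sub>R w q) = (if i = j then l i else 0)"
proof -
  have "(\<Sum>p\<in>UNIV. \<alpha> i $ p *\<^sub>R w p) \<bullet> (\<Sum>q\<in>UNIV. \<alpha> j $ q *\<^sub>R w q)
      = \<alpha> i \<bullet> ((\<chi> p q. w p \<bullet> w q) *v \<alpha> j)"
    by (simp add: inner_double_sum inner_vec_def matrix_vector_mult_def sum_distrib_left mult_ac)
  also have "\<dots> = (if i = j then l i else 0)"
    using sys by (simp add: matrix_eigensystem_def)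
  finally show ?thesis .
qed

text \<open>After expansion, the sum over \<open>i\<close> of
  \<open>\<alpha> i $ p * \<alpha> i $ q\<close> is the identity matrix by completeness.\<close>

lemma sum_tensor_orthonormal_change:
  fixes w :: "'s::finite \<Rightarrow> 'h::real_inner" and \<alpha> :: "'s \<Rightarrow> real ^ 's"
  assumes orth: "\<And>i j. \<alpha> i \<bullet> \<alpha> j = (if i = j then 1 else 0)"
  shows "(\<Sum>i\<in>UNIV. ((\<Sum>p\<in>UNIV. \<alpha> i $ p *\<^sub>R w p) \<bullet> f) *\<^sub>R (\<Sum>q\<in>UNIV. \<alpha> i $ q *\<^sub>R w q))
      = (\<Sum>p\<in>UNIV. (w p \<bullet> f) *\<^sub>R w p)"
proof -
  have "(\<Sum>i\<in>UNIV. ((\<Sum>p\<in>UNIV. \<alpha> i $ p *\<^sub>R w p) \<bullet> f) *\<^sub>R (\<Sum>q\<in>UNIV. \<alpha> i $ q *\<^sub>R w q))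
      = (\<Sum>i\<in>UNIV. \<Sum>p\<in>UNIV. \<Sum>q\<in>UNIV. (\<alpha> i $ p * \<alpha> i $ q * (w p \<bullet> f)) *\<^sub>R w q)"
    by (simp add: inner_sum_left scaleR_double_sum mult_ac)
  also have "\<dots> = (\<Sum>p\<in>UNIV. \<Sum>i\<in>UNIV. \<Sum>q\<in>UNIV. (\<alpha> i $ p * \<alpha> i $ q * (w p \<bullet> f)) *\<^sub>R w q)"
    by (rule sum.swap)
  also have "\<dots> = (\<Sum>p\<in>UNIV. \<Sum>q\<in>UNIV. \<Sum>i\<in>UNIV. (\<alpha> i $ p * \<alpha> i $ q * (w p \<bullet> f)) *\<^sub>R w q)"
    by (intro sum.cong refl sum.swap)
  also have "\<dots> = (\<Sum>p\<in>UNIV. \<Sum>q\<in>UNIV. ((\<Sum>i\<in>UNIV. \<alpha> i $ p * \<alpha> i $ q) * (w p \<bullet> f)) *\<^sub>R w q)"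
    by (simp add: sum_distrib_right flip: scaleR_sum_left)
  also have "\<dots> = (\<Sum>p\<in>UNIV. \<Sum>q\<in>UNIV. if p = q then (w p \<bullet> f) *\<^sub>R w q else 0)"
    by (intro sum.cong refl) (simp add: orthonormal_family_complete[OF orth])
  finally show ?thesis by simp
qed

text \<open>Recombining \<open>w\<close> with the Gram eigenvectors leaves \<open>B\<close>
  unchanged but makes the family orthogonal, with squared norms \<open>l i\<close>.\<close>

lemma spectral_apply_inner_gram:
  fixes w :: "'s::finite \<Rightarrow> 'h::{real_inner,complete_space}"
  assumes B: "\<And>f. B f = (\<Sum>p\<in>UNIV. (w p \<bullet> f) *\<^sub>R w p)"
    and sys: "matrix_eigensystem (\<chi> p q. w p \<bullet> w q) l \<alpha>"
  shows "spectral_apply h B f \<bullet> spectral_apply h B f'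
      = (h 0)\<^sup>2 * (f \<bullet> f') + (\<Sum>i | l i \<noteq> 0. ((h (l i))\<^sup>2 - (h 0)\<^sup>2) / l i
          * (\<alpha> i \<bullet> (\<chi> p. w p \<bullet> f)) * (\<alpha> i \<bullet> (\<chi> p. w p \<bullet> f')))"
proof -
  define v where "v i = (\<Sum>p\<in>UNIV. \<alpha> i $ p *\<^sub>R w p)" for i
  have orth: "\<alpha> i \<bullet> \<alpha> j = (if i = j then 1 else 0)" for i j
    using sys by (simp add: matrix_eigensystem_def)
  have v: "v i \<bullet> f = \<alpha> i \<bullet> (\<chi> p. w p \<bullet> f)" for i f
    by (simp add: v_def inner_sum_left inner_vec_def)
  have "B f = (\<Sum>i\<in>UNIV. (v i \<bullet> f) *\<^sub>R v i)" for f
    unfolding B v_def sum_tensor_orthonormal_change[OF orth] ..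
  then show ?thesis
    unfolding v[symmetric]
    by (rule spectral_apply_inner_orthogonal_family)
       (simp add: v_def gram_eigensystem_inner[OF sys])
qed

lemma gram_eigenvalue_nonneg:
  fixes w :: "'s::finite \<Rightarrow> 'h::real_inner"
  assumes "matrix_eigensystem (\<chi> p q. w p \<bullet> w q) l \<alpha>"
  shows "l i \<ge> 0"
  using gram_eigensystem_inner[OF assms, of i i]
    inner_ge_zero[of "\<Sum>p\<in>UNIV. \<alpha> i $ p *\<^sub>R w p"] by simp

section \<open>Positive semidefinite square roots and the centering matrix\<close>

lemma inner_matrix_vector_symmetric:
  fixes R :: "real ^ 's ^ 's"
  shows "transpose R = R \<Longrightarrow> u \<bullet> (R *v v) = (R *v u) \<bullet> v"
  by (metis dot_lmul_matrix vector_transpose_matrix)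

lemma psd_inner_commute: "psd M \<Longrightarrow> u \<bullet> (M *v v) = (M *v u) \<bullet> v"
  by (simp add: psd_def inner_matrix_vector_symmetric)

text \<open>Moving from \<open>v\<close> along \<open>M *v v\<close> would make the quadratic form
  negative for a suitable step, unless \<open>M *v v\<close> vanishes.\<close>

lemma psd_null:
  assumes "psd M" and "v \<bullet> (M *v v) = 0"
  shows "M *v v = 0"
proof -
  define u where "u = M *v v"
  define a where "a = u \<bullet> u"
  define b where "b = u \<bullet> (M *v u)"
  \<comment> \<open>The summand 1 keeps the denominator positive even if
    \<open>b = 0\<close>.\<close>
  define t where "t = - a / (b + 1)"
  have b: "b \<ge> 0" using assms(1) by (simp add: psd_def b_def)
  have "0 \<le> (v + t *\<^sub>R u) \<bullet> (M *v (v + t *\<^sub>R u))"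
    using assms(1) by (simp add: psd_def)
  also have "\<dots> = 2 * t * a + t\<^sup>2 * b"
    using assms(2) psd_inner_commute[OF assms(1), of v u]
    by (simp add: matrix_vector_right_distrib matrix_vector_mult_scaleR inner_add_left
        inner_add_right a_def b_def u_def[symmetric] power2_eq_square
        ring_distribs)
  also have "\<dots> = - a\<^sup>2 * (b + 2) / (b + 1)\<^sup>2"
    using b by (simp add: t_def divide_simps) (simp add: algebra_simps power2_eq_square)
  finally have "a\<^sup>2 * (b + 2) \<le> 0"
    using b by (simp add: divide_simps split: if_splits)
  then have "a\<^sup>2 \<le> 0"
    using b by (simp add: mult_le_0_iff)
  then show ?thesis by (simp add: a_def u_def)
qed

text \<open>By commutation, \<open>(P + R) ** (P - R) = 0\<close>. So \<open>P + R\<close> kills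
  every \<open>w = (P - R) *v x\<close>; by semidefiniteness \<open>P\<close> and \<open>R\<close>
  each kill it, and symmetry gives
  \<open>w \<bullet> w = x \<bullet> ((P - R) *v w) = 0\<close>.\<close>

lemma psd_commuting_sqrt_unique:
  assumes "psd P" "psd R" "P ** P = R ** R" and comm: "P ** R = R ** P"
  shows "P = R"
proof -
  have "(P - R) *v x = 0" for x
  proof -
    define w where "w = (P - R) *v x"
    have sum0: "P *v w + R *v w = 0"
      using assms(3) comm
      by (simp add: w_def matrix_vector_mult_diff_rdistrib matrix_vector_mult_diff_distrib
          matrix_vector_mul_assoc)
    have "w \<bullet> (P *v w) + w \<bullet> (R *v w) = 0"
      using sum0 by (metis inner_add_right inner_zero_right)
    moreover have "w \<bullet> (P *v w) \<ge> 0" "w \<bullet> (R *v w) \<ge> 0"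
      using assms by (auto simp: psd_def)
    ultimately have "P *v w = 0" "R *v w = 0"
      using assms by (auto intro: psd_null)
    then have "x \<bullet> (P *v w) - x \<bullet> (R *v w) = 0" by simp
    then have "w \<bullet> w = 0"
      using assms(1,2) by (simp add: psd_inner_commute w_def matrix_vector_mult_diff_rdistrib inner_diff_left)
    then show ?thesis by (simp add: w_def)
  qed
  then show ?thesis by (metis matrix_eq matrix_vector_mult_0 eq_iff_diff_eq_0)
qed

lemma transpose_centering: "transpose centering = (centering :: real ^ 's ^ 's)"
  by (simp add: centering_def transpose_def vec_eq_iff outer_def ones_def mat_def)

lemma centering_nth:
  "(centering :: real ^ 's ^ 's) $ i $ j = (if i = j then 1 else 0) - 1 / real CARD('s::finite)"
  by (simp add: centering_def outer_def ones_def mat_def)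

lemma centering_idem: "centering ** centering = (centering :: real ^ 's::finite ^ 's)"
proof -
  define c where "c = 1 / real CARD('s)"
  have "(\<Sum>k\<in>UNIV. (centering :: real ^ 's ^ 's) $ i $ k * (centering :: real ^ 's ^ 's) $ k $ j)
      = (centering :: real ^ 's ^ 's) $ i $ j" for i j :: 's
  proof -
    have "(\<Sum>k\<in>UNIV. (centering :: real ^ 's ^ 's) $ i $ k * (centering :: real ^ 's ^ 's) $ k $ j)
        = (\<Sum>k\<in>UNIV. (if k = i then (if i = j then 1 else 0) - c else 0)
            - (if k = j then c else 0) + c * c)"
      unfolding centering_nth c_def[symmetric] by (intro sum.cong refl) (auto simp: algebra_simps)
    \<comment> \<open>Summing the constant \<open>c * c\<close> over all indices gives
      \<open>c\<close>, which cancels one of the two terms \<open>- c\<close>.\<close>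
    also have "\<dots> = (if i = j then 1 else 0) - c"
      by (simp add: sum.distrib sum_subtractf) (simp add: c_def)
    finally show ?thesis by (simp add: centering_nth c_def)
  qed
  then show ?thesis by (simp add: matrix_matrix_mult_def vec_eq_iff)
qed

text \<open>For a symmetric idempotent matrix the quadratic form is a squared norm.\<close>

lemma psd_scaleR_centering:
  assumes "c \<ge> 0"
  shows "psd (c *\<^sub>R (centering :: real ^ 's::finite ^ 's))"
proof -
  have "v \<bullet> (centering *v v) = (centering *v v) \<bullet> (centering *v v)" for v :: "real ^ 's"
    by (metis centering_idem inner_matrix_vector_symmetric matrix_vector_mul_assoc
        transpose_centering)
  then have "0 \<le> v \<bullet> (centering *v v)" for v :: "real ^ 's"
    by simp
  then show ?thesis
    using assms transpose_centering[where 's='s]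
    by (simp add: psd_def scaleR_matrix_vector_assoc[symmetric] transpose_scalar)
qed

text \<open>The description in \<open>matrix_sqrt\<close> needs existence and uniqueness.
  Idempotence supplies the root \<open>sqrt c *\<^sub>R centering\<close>. Any root \<open>Q\<close>
  commutes with its own square, a positive multiple of \<open>centering\<close>, hence with that
  root.\<close>

lemma matrix_sqrt_scaled_centering:
  fixes R :: "real ^ 's::finite ^ 's"
  assumes "R = matrix_sqrt scaled_centering" and "CARD('s) \<ge> 2"
  shows "psd R" "R ** R = scaled_centering"
proof -
  define c where "c = real CARD('s) / (real CARD('s) - 1)"
  have c: "c > 0" using assms(2) by (simp add: c_def)
  have sc: "(scaled_centering :: real ^ 's ^ 's) = c *\<^sub>R centering"
    by (simp add: scaled_centering_def c_def)
  define P :: "real ^ 's ^ 's" where "P = sqrt c *\<^sub>R centering"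
  have P: "psd P" "P ** P = scaled_centering"
    using c by (auto simp: P_def psd_scaleR_centering matrix_scalar_ac scalar_matrix_assoc[symmetric] centering_idem sc)
  have "Q = P" if Q: "psd Q" "Q ** Q = scaled_centering" for Q :: "real ^ 's ^ 's"
  proof (rule psd_commuting_sqrt_unique)
    have centering: "centering = (1 / c) *\<^sub>R (Q ** Q)"
      using c by (simp add: Q(2) sc)
    have "Q ** centering = centering ** Q"
      unfolding centering by (simp add: matrix_scalar_ac scalar_matrix_assoc[symmetric] matrix_mul_assoc)
    then show "Q ** P = P ** Q"
      by (simp add: P_def matrix_scalar_ac scalar_matrix_assoc[symmetric])
  qed (use P Q in auto)
  then have "\<exists>!Q :: real ^ 's ^ 's. psd Q \<and> Q ** Q = scaled_centering"
    using P by blast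
  then have "psd R \<and> R ** R = scaled_centering"
    unfolding assms(1) matrix_sqrt_def by (rule theI')
  then show "psd R" "R ** R = scaled_centering" by auto
qed

section \<open>Kernel sections and the covariance estimator\<close>

lemma rkhs_kernel:
  assumes "rkhs ev K"
  shows "kernel_section ev K x \<bullet> kernel_section ev K y = K x y"
    and "K x y = K y x"
proof -
  have inj: "inj ev" using assms by (simp add: rkhs_def)
  have "ev (kernel_section ev K x) = (\<lambda>y. K y x)
      \<and> (\<forall>f. ev f x = f \<bullet> kernel_section ev K x)" for x
  proof -
    obtain k where k: "ev k = (\<lambda>y. K y x)" "\<forall>f. ev f x = f \<bullet> k"
      using assms unfolding rkhs_def by blast
    then have "kernel_section ev K x = k"
      unfolding kernel_section_def using inj by (intro the_equality) (auto simp: inj_def)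
    with k show ?thesis by simp
  qed
  then have *: "kernel_section ev K x \<bullet> kernel_section ev K y = K y x" for x y
    by metis
  then show "K x y = K y x" by (metis inner_commute)
  then show "kernel_section ev K x \<bullet> kernel_section ev K y = K x y" by (simp add: *)
qed

text \<open>Expanding the differences turns the average over pairs into a centred second
  moment.\<close>

lemma cov_estimator_expand:
  fixes ev :: "'h::{real_inner,complete_space} \<Rightarrow> 'x \<Rightarrow> real" and K :: "'x \<Rightarrow> 'x \<Rightarrow> real"
    and Z :: "'s::finite \<Rightarrow> 'x"
  defines "k \<equiv> \<lambda>p. kernel_section ev K (Z p)"
  assumes "CARD('s) \<ge> 2"
  shows "cov_estimator ev K Z f = (1 / (real CARD('s) - 1)) *\<^sub>R
    ((\<Sum>p\<in>UNIV. (k p \<bullet> f) *\<^sub>R k p)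
      - (1 / real CARD('s)) *\<^sub>R ((\<Sum>p\<in>UNIV. k p \<bullet> f) *\<^sub>R (\<Sum>q\<in>UNIV. k q)))"
proof -
  let ?s = "real CARD('s)"
  \<comment> \<open>The terms with \<open>j = i\<close> vanish, so they may be included.\<close>
  have "(\<Sum>i\<in>UNIV. \<Sum>j\<in>UNIV - {i}. tensor (k i - k j) (k i - k j) f)
      = (\<Sum>i\<in>UNIV. \<Sum>j\<in>UNIV. tensor (k i - k j) (k i - k j) f)"
    by (intro sum.cong sum.mono_neutral_left) (auto simp: tensor_apply)
  also have "\<dots> = (\<Sum>i\<in>UNIV. \<Sum>j\<in>UNIV. (k i \<bullet> f) *\<^sub>R k i + (k j \<bullet> f) *\<^sub>R k j
      - ((k i \<bullet> f) *\<^sub>R k j + (k j \<bullet> f) *\<^sub>R k i))"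
    by (intro sum.cong refl) (simp add: tensor_apply inner_diff_left algebra_simps)
  also have "\<dots> = (2 * ?s) *\<^sub>R (\<Sum>p\<in>UNIV. (k p \<bullet> f) *\<^sub>R k p)
      - 2 *\<^sub>R ((\<Sum>p\<in>UNIV. k p \<bullet> f) *\<^sub>R (\<Sum>q\<in>UNIV. k q))"
  proof -
    have "(\<Sum>i\<in>UNIV. (?s * (k i \<bullet> f)) *\<^sub>R k i) = ?s *\<^sub>R (\<Sum>p\<in>UNIV. (k p \<bullet> f) *\<^sub>R k p)"
      by (simp add: scaleR_sum_right)
    then show ?thesis
      by (simp add: sum.distrib sum_subtractf sum_constant_scaleR
          flip: scaleR_sum_right scaleR_sum_left)
        (simp only: mult_2 scaleR_left_distrib)
  qed
  finally show ?thesis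
    using assms(2) unfolding cov_estimator_def k_def
    by (simp add: scaleR_diff_right)
qed

text \<open>Summing over \<open>j\<close> leaves the entries of \<open>R ** R\<close> divided by the
  sample size, which are exactly the coefficients of the centred second moment.\<close>

lemma cov_estimator_eq_sum_tensor:
  fixes ev :: "'h::{real_inner,complete_space} \<Rightarrow> 'x \<Rightarrow> real" and K :: "'x \<Rightarrow> 'x \<Rightarrow> real"
    and Z :: "'s::finite \<Rightarrow> 'x"
    and R :: "real ^ 's ^ 's"
  defines "w \<equiv> \<lambda>j. (1 / sqrt (real CARD('s))) *\<^sub>R (\<Sum>p\<in>UNIV. R $ j $ p *\<^sub>R kernel_section ev K (Z p))"
  assumes s: "CARD('s) \<ge> 2" and R: "transpose R = R" "R ** R = scaled_centering"
  shows "cov_estimator ev K Z f = (\<Sum>j\<in>UNIV. (w j \<bullet> f) *\<^sub>R w j)"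
proof -
  let ?s = "real CARD('s)"
  define k where "k p = kernel_section ev K (Z p)" for p
  have R_sym: "R $ j $ p = R $ p $ j" for j p
    using R(1) by (simp add: transpose_def vec_eq_iff)
  have RR: "(\<Sum>j\<in>UNIV. R $ j $ p * R $ j $ q) = ?s / (?s - 1) * ((if p = q then 1 else 0) - 1 / ?s)" for p q
  proof -
    have "(\<Sum>j\<in>UNIV. R $ j $ p * R $ j $ q) = (R ** R) $ p $ q"
      by (simp add: matrix_matrix_mult_def R_sym[of _ p])
    then show ?thesis
      unfolding R(2) scaled_centering_def by (simp add: centering_nth)
  qed
  have "(w j \<bullet> f) *\<^sub>R w j
      = (\<Sum>p\<in>UNIV. \<Sum>q\<in>UNIV. (1 / ?s * (R $ j $ p * R $ j $ q) * (k p \<bullet> f)) *\<^sub>R k q)" for j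
  proof -
    have "(w j \<bullet> f) *\<^sub>R w j = (1 / ?s) *\<^sub>R
        ((\<Sum>p\<in>UNIV. R $ j $ p * (k p \<bullet> f)) *\<^sub>R (\<Sum>q\<in>UNIV. R $ j $ q *\<^sub>R k q))"
      by (simp add: w_def k_def inner_sum_left)
    also have "\<dots> = (1 / ?s) *\<^sub>R
        (\<Sum>p\<in>UNIV. \<Sum>q\<in>UNIV. (R $ j $ p * (k p \<bullet> f)) *\<^sub>R (R $ j $ q *\<^sub>R k q))"
      by (simp only: scaleR_double_sum)
    finally show ?thesis by (simp add: scaleR_sum_right mult_ac)
  qed
  then have "(\<Sum>j\<in>UNIV. (w j \<bullet> f) *\<^sub>R w j)
      = (\<Sum>j\<in>UNIV. \<Sum>p\<in>UNIV. \<Sum>q\<in>UNIV. (1 / ?s * (R $ j $ p * R $ j $ q) * (k p \<bullet> f)) *\<^sub>R k q)"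
    by simp
  also have "\<dots> = (\<Sum>p\<in>UNIV. \<Sum>j\<in>UNIV. \<Sum>q\<in>UNIV. (1 / ?s * (R $ j $ p * R $ j $ q) * (k p \<bullet> f)) *\<^sub>R k q)"
    by (rule sum.swap)
  also have "\<dots> = (\<Sum>p\<in>UNIV. \<Sum>q\<in>UNIV. \<Sum>j\<in>UNIV. (1 / ?s * (R $ j $ p * R $ j $ q) * (k p \<bullet> f)) *\<^sub>R k q)"
    by (intro sum.cong refl sum.swap)
  also have "\<dots> = (\<Sum>p\<in>UNIV. \<Sum>q\<in>UNIV. (1 / ?s * (\<Sum>j\<in>UNIV. R $ j $ p * R $ j $ q) * (k p \<bullet> f)) *\<^sub>R k q)"
    by (simp add: sum_distrib_left sum_distrib_right flip: scaleR_sum_left)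
  also have "\<dots> = (\<Sum>p\<in>UNIV. \<Sum>q\<in>UNIV. (1 / (?s - 1)) *\<^sub>R
      ((if p = q then (k p \<bullet> f) *\<^sub>R k p else 0) - (1 / ?s) *\<^sub>R ((k p \<bullet> f) *\<^sub>R k q)))"
    using s unfolding RR by (intro sum.cong refl) (simp add: algebra_simps diff_divide_distrib)
  also have "\<dots> = cov_estimator ev K Z f"
    unfolding cov_estimator_expand[OF s]
    by (simp add: k_def sum_subtractf flip: scaleR_sum_right scaleR_sum_left sum_divide_distrib)
  finally show ?thesis by simp
qed

section \<open>Matrix entries and sums over distinct indices\<close>

text \<open>Symmetry moves the outer factors \<open>R\<close> onto the rows of \<open>N\<close> and
  \<open>N'\<close>; each rank-one term between them then splits into two inner products.\<close>

lemma sandwich_nth: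
  fixes N :: "real ^ 's ^ 'k" and N' :: "real ^ 's ^ 'l" and R :: "real ^ 's::finite ^ 's"
    and \<alpha> :: "'i \<Rightarrow> real ^ 's"
  assumes "transpose R = R"
  shows "(N ** R ** (\<Sum>a\<in>I. c a *\<^sub>R outer (\<alpha> a) (\<alpha> a)) ** R ** transpose N') $ i $ j
      = (\<Sum>a\<in>I. c a * (\<alpha> a \<bullet> (R *v (N $ i))) * (\<alpha> a \<bullet> (R *v (N' $ j))))"
proof -
  have outer: "outer a a *v u = (a \<bullet> u) *\<^sub>R a" for a u :: "real ^ 's"
    by (simp add: outer_def matrix_vector_mult_def vec_eq_iff inner_vec_def sum_distrib_left
        sum_distrib_right mult_ac)
  have sum_mv: "(\<Sum>a\<in>I. M a) *v u = (\<Sum>a\<in>I. M a *v u)" for M :: "'i \<Rightarrow> real ^ 's ^ 's" and u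
    by (induction I rule: infinite_finite_induct)
       (auto simp: matrix_vector_mult_add_rdistrib)
  define G where "G = (\<Sum>a\<in>I. c a *\<^sub>R outer (\<alpha> a) (\<alpha> a))"
  have "(N ** R ** G ** R ** transpose N') $ i $ j = N $ i \<bullet> ((R ** G ** R) *v (N' $ j))"
  proof -
    have "(N ** (R ** G ** R) ** transpose N') $ i $ j = N $ i \<bullet> ((R ** G ** R) *v (N' $ j))"
      unfolding matrix_mul_assoc[symmetric, of N]
      by (simp only: matrix_matrix_mult_def[of N] matrix_matrix_mult_def[of _ "transpose N'"])
         (simp add: inner_vec_def matrix_vector_mult_def transpose_def)
    then show ?thesis by (simp add: matrix_mul_assoc)
  qed
  also have "\<dots> = (R *v (N $ i)) \<bullet> (G *v (R *v (N' $ j)))"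
    by (simp add: inner_matrix_vector_symmetric[OF assms] flip: matrix_vector_mul_assoc)
  also have "\<dots> = (\<Sum>a\<in>I. c a * (\<alpha> a \<bullet> (R *v (N $ i))) * (\<alpha> a \<bullet> (R *v (N' $ j))))"
    by (simp add: G_def sum_mv outer inner_sum_right inner_commute mult_ac
        flip: scaleR_matrix_vector_assoc)
  finally show ?thesis by (simp add: G_def)
qed

lemma ones_quadratic: "ones \<bullet> (A *v ones) = (\<Sum>i\<in>UNIV. \<Sum>j\<in>UNIV. A $ i $ j)"
  by (simp add: ones_def inner_vec_def matrix_vector_mult_def)

text \<open>Terms from one sample alone are repeated once per distinct pair of the other. In a mixed
  term each of the two omitted indices avoids one value, and both mixed terms have the same
  sum.\<close>

lemma sum_distinct_pairs:
  fixes p :: "'n::finite \<Rightarrow> 'n \<Rightarrow> real" and b :: "'m::finite \<Rightarrow> 'm \<Rightarrow> real"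
    and q :: "'m \<Rightarrow> 'n \<Rightarrow> real"
  shows "(\<Sum>i\<in>UNIV. \<Sum>j\<in>UNIV - {i}. \<Sum>i'\<in>UNIV. \<Sum>j'\<in>UNIV - {i'}.
        p i j - q j' i - q i' j + b i' j')
    = real CARD('m) * (real CARD('m) - 1) * ((\<Sum>i\<in>UNIV. \<Sum>j\<in>UNIV. p i j) - (\<Sum>i\<in>UNIV. p i i))
      + real CARD('n) * (real CARD('n) - 1) * ((\<Sum>i\<in>UNIV. \<Sum>j\<in>UNIV. b i j) - (\<Sum>i\<in>UNIV. b i i))
      - 2 * (real CARD('n) - 1) * (real CARD('m) - 1) * (\<Sum>i\<in>UNIV. \<Sum>j\<in>UNIV. q i j)"
proof -
  have off: "(\<Sum>j\<in>UNIV - {i}. F j) = (\<Sum>j\<in>UNIV. F j) - F i" for F :: "'k::finite \<Rightarrow> real" and i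
    by (simp add: sum_diff1)
  have swap: "(\<Sum>i\<in>UNIV. \<Sum>j\<in>UNIV. q j i) = (\<Sum>i\<in>UNIV. \<Sum>j\<in>UNIV. q i j)"
    by (rule sum.swap)
  show ?thesis
    by (simp add: off sum.distrib sum_subtractf swap flip: sum_distrib_left sum_distrib_right)
       (simp add: algebra_simps)
qed

theorem theorem4p1:
  fixes ev :: "'h::{real_inner,complete_space} \<Rightarrow> 'x::second_countable_topology \<Rightarrow> real"
    and K :: "'x \<Rightarrow> 'x \<Rightarrow> real" and \<kappa> :: real
    and g :: "real \<Rightarrow> real \<Rightarrow> real" and lam :: real
    and X :: "'n::finite \<Rightarrow> 'x" and Y :: "'m::finite \<Rightarrow> 'x" and Z :: "'s::finite \<Rightarrow> 'x"
    and l :: "'s \<Rightarrow> real" and \<alpha> :: "'s \<Rightarrow> real ^ 's"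
    and Kn :: "real ^ 'n ^ 'n" and Km :: "real ^ 'm ^ 'm" and Ks :: "real ^ 's ^ 's"
    and Kns :: "real ^ 's ^ 'n" and Kms :: "real ^ 's ^ 'm" and Kmn :: "real ^ 'n ^ 'm"
    and R G :: "real ^ 's ^ 's" and A1 :: "real ^ 'n ^ 'n" and A2 :: "real ^ 'm ^ 'm"
    and a1 a2 a3 a4 a5 :: real
  assumes "rkhs ev K"
    and "continuous_on UNIV (\<lambda>(x, y). K x y)"
    and "\<And>x. K x x \<le> \<kappa>"
    and "CARD('n) \<ge> 2" and "CARD('m) \<ge> 2" and "CARD('s) \<ge> 2"
    and "lam > 0" and "\<And>t. t \<ge> 0 \<Longrightarrow> g lam t \<ge> 0"
    and "Kn = kernel_matrix K X X" and "Km = kernel_matrix K Y Y" and "Ks = kernel_matrix K Z Z"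
    and "Kns = kernel_matrix K X Z" and "Kms = kernel_matrix K Y Z" and "Kmn = kernel_matrix K Y X"
    and "R = matrix_sqrt scaled_centering"
    and "matrix_eigensystem ((1 / real CARD('s)) *\<^sub>R (R ** Ks ** R)) l \<alpha>"
    and "G = (\<Sum>i | l i \<noteq> 0. ((g lam (l i) - g lam 0) / l i) *\<^sub>R outer (\<alpha> i) (\<alpha> i))"
    and "A1 = g lam 0 *\<^sub>R Kn + (1 / real CARD('s)) *\<^sub>R (Kns ** R ** G ** R ** transpose Kns)"
    and "A2 = g lam 0 *\<^sub>R Km + (1 / real CARD('s)) *\<^sub>R (Kms ** R ** G ** R ** transpose Kms)"
    and "a1 = ones \<bullet> (A1 *v ones)" and "a2 = trace A1"
    and "a3 = ones \<bullet> (A2 *v ones)" and "a4 = trace A2"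
    and "a5 = ones \<bullet> ((g lam 0 *\<^sub>R Kmn
           + (1 / real CARD('s)) *\<^sub>R (Kms ** R ** G ** R ** transpose Kns)) *v ones)"
  shows "test_statistic ev K (g lam) X Y Z =
      1 / (real CARD('n) * (real CARD('n) - 1)) * (a1 - a2)
      + 1 / (real CARD('m) * (real CARD('m) - 1)) * (a3 - a4)
      - 2 / (real CARD('n) * real CARD('m)) * a5"
proof -
  let ?s = "real CARD('s)"
  note rkhs = assms(1) and n = assms(4) and m = assms(5) and s = assms(6)
    and g_nonneg = assms(8) and G = assms(17)
  define k where "k = kernel_section ev K"
  have k: "k x \<bullet> k y = K x y" and K_sym: "K x y = K y x" for x y
    using rkhs_kernel[OF rkhs] by (auto simp: k_def)
  have R: "transpose R = R" and RR: "R ** R = scaled_centering"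
    using matrix_sqrt_scaled_centering[OF assms(15) s] by (auto simp: psd_def)
  have R_sym: "R $ i $ j = R $ j $ i" for i j
    using R by (simp add: transpose_def vec_eq_iff)
  define w where "w j = (1 / sqrt ?s) *\<^sub>R (\<Sum>p\<in>UNIV. R $ j $ p *\<^sub>R k (Z p))" for j
  have cov: "cov_estimator ev K Z f = (\<Sum>j\<in>UNIV. (w j \<bullet> f) *\<^sub>R w j)" for f
    unfolding w_def k_def by (rule cov_estimator_eq_sum_tensor[OF s R RR])
  \<comment> \<open>The two factors \<open>1 / sqrt ?s\<close> multiply to \<open>1 / ?s\<close>,
    and symmetry of \<open>R\<close> matches the row and column indices.\<close>
  have gram: "(1 / ?s) *\<^sub>R (R ** Ks ** R) = (\<chi> p q. w p \<bullet> w q)"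
    by (simp add: vec_eq_iff w_def inner_sum_left inner_sum_right k assms(11) kernel_matrix_def
        matrix_matrix_mult_def sum_distrib_left sum_distrib_right R_sym mult_ac)
  have sys: "matrix_eigensystem (\<chi> p q. w p \<bullet> w q) l \<alpha>"
    using assms(16) by (simp add: gram)
  have l: "l i \<ge> 0" for i
    by (rule gram_eigenvalue_nonneg[OF sys])
  define T where "T = spectral_apply (\<lambda>t. sqrt (g lam t)) (cov_estimator ev K Z)"
  define e where "e i f = \<alpha> i \<bullet> (\<chi> p. w p \<bullet> f)" for i f
  define c where "c i = (g lam (l i) - g lam 0) / l i" for i
  \<comment> \<open>This is the bilinear form of \<open>g lam\<close> applied to the covariance
    estimator.\<close>
  define Q where "Q f f' = g lam 0 * (f \<bullet> f')
      + (\<Sum>i | l i \<noteq> 0. c i * e i f * e i f')" for f f'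
  have T: "T f \<bullet> T f' = Q f f'" for f f'
    \<comment> \<open>Squaring \<open>sqrt (g lam t)\<close> returns \<open>g lam t\<close> only
      where it is nonnegative; this holds at 0 and at each \<open>l i \<ge> 0\<close>.\<close>
    unfolding T_def spectral_apply_inner_gram[OF cov sys] Q_def e_def c_def
    by (simp add: g_nonneg l)
  have e_diff: "e i (f - f') = e i f - e i f'" for i f f'
  proof -
    have "(\<chi> p. w p \<bullet> (f - f')) = (\<chi> p. w p \<bullet> f) - (\<chi> p. w p \<bullet> f')"
      by (simp add: vec_eq_iff inner_diff_right)
    then show ?thesis by (simp add: e_def inner_diff_right)
  qed
  have Q_diff: "Q (f - f') (h - h') = Q f h - Q f h' - Q f' h + Q f' h'" for f f' h h'
    unfolding Q_def e_diff
    by (simp add: inner_diff_left inner_diff_right algebra_simps sum.distrib sum_subtractf)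
  have Q_sym: "Q f f' = Q f' f" for f f'
    by (simp add: Q_def inner_commute mult_ac)
  have e_k: "e i (k x) = (1 / sqrt ?s) * (\<alpha> i \<bullet> (R *v (\<chi> p. K x (Z p))))" for i x
  proof -
    have "(\<chi> p. w p \<bullet> k x) = (1 / sqrt ?s) *\<^sub>R (R *v (\<chi> p. K x (Z p)))"
      by (simp add: vec_eq_iff w_def matrix_vector_mult_def inner_sum_left k K_sym[of x])
    then show ?thesis by (simp add: e_def)
  qed
  \<comment> \<open>Arbitrary samples \<open>U\<close> and \<open>V\<close> let one identity cover
    \<open>A1\<close>, \<open>A2\<close> and the matrix inside \<open>a5\<close>.\<close>
  have entry: "(g lam 0 *\<^sub>R kernel_matrix K U V + (1 / ?s) *\<^sub>R
      (kernel_matrix K U Z ** R ** G ** R ** transpose (kernel_matrix K V Z))) $ i $ j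
      = Q (k (U i)) (k (V j))" for U :: "'k::finite \<Rightarrow> 'x" and V :: "'l::finite \<Rightarrow> 'x" and i j
    by (simp add: G sandwich_nth[OF R] Q_def c_def e_k k sum_divide_distrib)
       (simp add: kernel_matrix_def mult_ac)
  have a: "a1 = (\<Sum>i\<in>UNIV. \<Sum>j\<in>UNIV. Q (k (X i)) (k (X j)))"
    "a2 = (\<Sum>i\<in>UNIV. Q (k (X i)) (k (X i)))"
    "a3 = (\<Sum>i\<in>UNIV. \<Sum>j\<in>UNIV. Q (k (Y i)) (k (Y j)))"
    "a4 = (\<Sum>i\<in>UNIV. Q (k (Y i)) (k (Y i)))"
    "a5 = (\<Sum>i\<in>UNIV. \<Sum>j\<in>UNIV. Q (k (Y i)) (k (X j)))"
    unfolding assms(9-14) assms(18-24) ones_quadratic trace_def entry by (rule refl)+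
  have "test_statistic ev K (g lam) X Y Z
      = 1 / (real CARD('n) * (real CARD('n) - 1)) * (1 / (real CARD('m) * (real CARD('m) - 1))) *
         (\<Sum>i\<in>UNIV. \<Sum>j\<in>UNIV - {i}. \<Sum>i'\<in>UNIV. \<Sum>j'\<in>UNIV - {i'}.
            Q (k (X i) - k (Y i')) (k (X j) - k (Y j')))"
    by (simp add: test_statistic_def Let_def T[unfolded T_def] k_def)
  also have "(\<Sum>i\<in>UNIV. \<Sum>j\<in>UNIV - {i}. \<Sum>i'\<in>UNIV. \<Sum>j'\<in>UNIV - {i'}.
            Q (k (X i) - k (Y i')) (k (X j) - k (Y j')))
      = (\<Sum>i\<in>UNIV. \<Sum>j\<in>UNIV - {i}. \<Sum>i'\<in>UNIV. \<Sum>j'\<in>UNIV - {i'}.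
          Q (k (X i)) (k (X j)) - Q (k (Y j')) (k (X i)) - Q (k (Y i')) (k (X j))
          + Q (k (Y i')) (k (Y j')))"
    \<comment> \<open>Symmetry puts the \<open>Y\<close> argument first in both mixed terms, as in
      \<open>Kmn\<close>.\<close>
    unfolding Q_diff by (simp only: Q_sym[of "k (X _)" "k (Y _)"])
  also have "\<dots> = real CARD('m) * (real CARD('m) - 1) * (a1 - a2)
      + real CARD('n) * (real CARD('n) - 1) * (a3 - a4)
      - 2 * (real CARD('n) - 1) * (real CARD('m) - 1) * a5"
    unfolding a by (rule sum_distinct_pairs)
  \<comment> \<open>Sample sizes of at least 2 make the denominators nonzero; cancelling
    \<open>n - 1\<close> and \<open>m - 1\<close> leaves the factor 2 over the product of the
    sizes.\<close>
  finally show ?thesis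
    using n m by (simp add: divide_simps) (simp add: algebra_simps)
qed

end
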